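(* Let $A,B\in L(\mathcal{H})$ with $R(A+B)$ closed. Let $W\in L(\mathcal{H})^+$ be such that the pair $(W,R(A+B))$ is compatible and $A \;{}_{*_W}\!\!\leq\; A+B$. Then $$W_{R(A+B)}=W_{R(A)}+W_{R(B)}.$$
   Context: $\mathcal{H}$ is a separable complex Hilbert space, $L(\mathcal{H})$ the algebra of bounded linear operators on $\mathcal{H}$, $L(\mathcal{H})^+$ the cone of positive semidefinite operators, and $\leq$ the order induced by this cone. $R(T)$ denotes the range of $T$. For a subspace $\mathcal{S}$, $\mathcal{S}^{\perp_W}=\{x\in\mathcal{H}: \langle Wx,y\rangle=0 \text{ for all } y\in\mathcal{S}\}$. $\dotplus$ denotes direct sum of subspaces. Shorted operator and compression: for a closed subspace $\mathcal{S}$, $W_{/\mathcal{S}}$ is the maximum, with respect to $\leq$ (known to exist), of $\{X\in L(\mathcal{H}): 0\leq X\leq W,\ R(X)\subseteq \mathcal{S}^\perp\}$, and the $\mathcal{S}$-compression of $W$ is $W_{\mathcal{S}}=W-W_{/\mathcal{S}}$. (Under the hypotheses $R(A+B)$ closed and $R(A+B)=R(A)\dotplus R(B)$, it is known that $R(A)$ and $R(B)$ are closed.) Compatibility: the pair $(W,\mathcal{T})$, with $\mathcal{T}$ a closed subspace, is compatible if there exists $Q\in L(\mathcal{H})$ with $Q^2=Q$, $R(Q)=\mathcal{T}$ and $WQ=Q^*W$. Left minus order: $C \;{}_{-}\!\!\leq\; D$ means $R(D)=R(C)\dotplus R(D-C)$. Left weighted star order: $C \;{}_{*_W}\!\!\leq\;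 D$ means $C \;{}_{-}\!\!\leq\; D$ and $R(D-C)\subseteq R(C)^{\perp_W}$. *)

theory Defs
  imports "HOL-Analysis.Analysis" "HOL-Library.Set_Algebras"
begin

(* A complex Hilbert space is presented on top of its underlying real Hilbert space: the real
   inner product is the real part of the complex one, so the norm is the usual one and the
   library for real_inner and for bounded linear maps applies.  The complex inner product is
   linear in its first and conjugate-linear in its second argument. *)

class complex_inner = real_inner +
  fixes scaleC :: "complex \<Rightarrow> 'a \<Rightarrow> 'a"  (infixr "*\<^sub>C" 75)
    and cinner :: "'a \<Rightarrow> 'a \<Rightarrow> complex"
  assumes scaleC_add_right: "c *\<^sub>C (x + y) = c *\<^sub>C x + c *\<^sub>C y"
    and scaleC_add_left: "(c + d) *\<^sub>C x = c *\<^sub>C x + d *\<^sub>C x"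
    and scaleC_scaleC: "c *\<^sub>C (d *\<^sub>C x) = (c * d) *\<^sub>C x"
    and scaleC_of_real: "complex_of_real r *\<^sub>C x = r *\<^sub>R x"
    and cinner_add_left: "cinner (x + y) z = cinner x z + cinner y z"
    and cinner_scaleC_left: "cinner (c *\<^sub>C x) y = c * cinner x y"
    and cinner_commute: "cinner x y = cnj (cinner y x)"
    and Re_cinner: "Re (cinner x y) = inner x y"

class chilbert_space = complex_inner + complete_space

lemma cinner_self: "cinner x x = complex_of_real ((norm x)\<^sup>2)"
  for x :: "'a :: complex_inner"
proof (rule complex_eqI)
  show "Re (cinner x x) = Re (complex_of_real ((norm x)\<^sup>2))"
    by (simp only: Re_cinner power2_norm_eq_inner Re_complex_of_real)
  have "Im (cinner x x) = - Im (cinner x x)"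
    using arg_cong[OF cinner_commute[of x x], of Im] by simp
  then show "Im (cinner x x) = Im (complex_of_real ((norm x)\<^sup>2))" by simp
qed

instantiation complex :: chilbert_space
begin

definition scaleC_complex :: "complex \<Rightarrow> complex \<Rightarrow> complex"
  where "scaleC_complex c x = c * x"

definition cinner_complex :: "complex \<Rightarrow> complex \<Rightarrow> complex"
  where "cinner_complex x y = x * cnj y"

instance
  by standard (auto simp: scaleC_complex_def cinner_complex_def inner_complex_def scaleR_conv_of_real
       algebra_simps)

end

(* L(H): the library type of bounded real-linear maps, cut down to the complex-linear ones. *)
definition bounded_ops :: "('a :: complex_inner \<Rightarrow>\<^sub>L 'a) set"
  where "bounded_ops = {T. \<forall>c x. blinfun_apply T (c *\<^sub>C x) = c *\<^sub>C blinfun_apply T x}"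

abbreviation op_range :: "('a :: real_normed_vector \<Rightarrow>\<^sub>L 'a) \<Rightarrow> 'a set"
  where "op_range T \<equiv> range (blinfun_apply T)"

definition adj :: "('a :: complex_inner \<Rightarrow>\<^sub>L 'a) \<Rightarrow> ('a \<Rightarrow>\<^sub>L 'a)"
  where "adj T = (THE S. S \<in> bounded_ops \<and> (\<forall>x y. cinner (T x) y = cinner x (S y)))"

definition pos_ops :: "('a :: complex_inner \<Rightarrow>\<^sub>L 'a) set"
  where "pos_ops = {T \<in> bounded_ops. \<forall>x. cinner (T x) x \<in> \<real>\<^sub>\<ge>\<^sub>0}"

definition op_le :: "('a :: complex_inner \<Rightarrow>\<^sub>L 'a) \<Rightarrow> ('a \<Rightarrow>\<^sub>L 'a) \<Rightarrow> bool"
  where "op_le X Y \<longleftrightarrow> Y - X \<in> pos_ops"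

definition ortho_compl :: "'a :: complex_inner set \<Rightarrow> 'a set"
  where "ortho_compl S = {x. \<forall>y\<in>S. cinner x y = 0}"

definition weighted_ortho_compl :: "('a :: complex_inner \<Rightarrow>\<^sub>L 'a) \<Rightarrow> 'a set \<Rightarrow> 'a set"
  where "weighted_ortho_compl W S = {x. \<forall>y\<in>S. cinner (W x) y = 0}"

definition is_direct_sum :: "'a :: complex_inner set \<Rightarrow> 'a set \<Rightarrow> 'a set \<Rightarrow> bool"
  where "is_direct_sum U M N \<longleftrightarrow> U = M + N \<and> M \<inter> N = {0}"

definition shorted_candidates ::
    "('a :: complex_inner \<Rightarrow>\<^sub>L 'a) \<Rightarrow> 'a set \<Rightarrow> ('a \<Rightarrow>\<^sub>L 'a) set"
  where "shorted_candidates W S =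
    {X \<in> bounded_ops. op_le 0 X \<and> op_le X W \<and> op_range X \<subseteq> ortho_compl S}"

definition shorted :: "('a :: complex_inner \<Rightarrow>\<^sub>L 'a) \<Rightarrow> 'a set \<Rightarrow> ('a \<Rightarrow>\<^sub>L 'a)"
  where "shorted W S =
    (THE X. X \<in> shorted_candidates W S \<and> (\<forall>Y \<in> shorted_candidates W S. op_le Y X))"

definition compression :: "('a :: complex_inner \<Rightarrow>\<^sub>L 'a) \<Rightarrow> 'a set \<Rightarrow> ('a \<Rightarrow>\<^sub>L 'a)"
  where "compression W S = W - shorted W S"

definition compatible :: "('a :: complex_inner \<Rightarrow>\<^sub>L 'a) \<Rightarrow> 'a set \<Rightarrow> bool"
  where "compatible W S \<longleftrightarrow>
    (\<exists>Q \<in> bounded_ops. Q o\<^sub>L Q = Q \<and> op_range Q = S \<and> W o\<^sub>L Q = adj Q o\<^sub>L W)"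

definition left_minus_le :: "('a :: complex_inner \<Rightarrow>\<^sub>L 'a) \<Rightarrow> ('a \<Rightarrow>\<^sub>L 'a) \<Rightarrow> bool"
  where "left_minus_le C D \<longleftrightarrow> is_direct_sum (op_range D) (op_range C) (op_range (D - C))"

definition left_weighted_star_le ::
    "('a :: complex_inner \<Rightarrow>\<^sub>L 'a) \<Rightarrow> ('a \<Rightarrow>\<^sub>L 'a) \<Rightarrow> ('a \<Rightarrow>\<^sub>L 'a) \<Rightarrow> bool"
  where "left_weighted_star_le W C D \<longleftrightarrow>
    left_minus_le C D \<and> op_range (D - C) \<subseteq> weighted_ortho_compl W (op_range C)"

end

theory Submission
  imports Defs
begin

text \<open>
  Write \<open>S\<close> for the range of \<open>A + B\<close>.  The point of the proof is that a compression is given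
  pointwise by any \<open>W\<close>-orthogonal decomposition: if \<open>T\<close> is a subspace such that every vector \<open>x\<close>
  can be written \<open>x = e + (x - e)\<close> with \<open>e \<in> T\<close> and \<open>x - e\<close> in the \<open>W\<close>-orthogonal complement of
  \<open>T\<close>, then the compression of \<open>W\<close> to \<open>T\<close> maps \<open>x\<close> to \<open>W e\<close> (\<open>compression_apply\<close>).  The vector
  \<open>e\<close> need not be unique, nor depend boundedly on \<open>x\<close>; but \<open>W e\<close> is unique and, by the
  Pythagorean inequality \<open>\<langle>W e, e\<rangle> \<le> \<langle>W x, x\<rangle>\<close>, depends boundedly on \<open>x\<close>.  Moreover,
  \<open>\<langle>W x - W e, x\<rangle> = \<langle>W (x - e), x - e\<rangle>\<close>, and a competitor \<open>Y\<close> for the shorted operator kills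
  \<open>T\<close>, so that \<open>\<langle>Y x, x\<rangle> = \<langle>Y (x - e), x - e\<rangle> \<le> \<langle>W (x - e), x - e\<rangle>\<close>; hence \<open>x \<mapsto> W x - W e\<close> is
  the largest competitor.

  A projection \<open>Q\<close> onto \<open>S\<close> with \<open>W Q = Q\<^sup>* W\<close> gives such a decomposition for \<open>S\<close>, with
  \<open>e = Q x\<close>.  Split \<open>Q x = t + u\<close> along \<open>S = R(A) + R(B)\<close>.  As \<open>R(A)\<close> and \<open>R(B)\<close> are
  \<open>W\<close>-orthogonal, \<open>t\<close> and \<open>u\<close> serve as the components of \<open>x\<close> for \<open>R(A)\<close> and for \<open>R(B)\<close>, and the
  claim becomes \<open>W (Q x) = W t + W u\<close>.  Since only \<open>W t\<close> and \<open>W u\<close> enter, the proof can do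
  without a bounded projection of \<open>S\<close> onto \<open>R(A)\<close> along \<open>R(B)\<close>.

  To use \<open>Q\<^sup>*\<close> at all, the existence of adjoints must be known; it is derived from the Riesz
  representation theorem (\<open>riesz_representation\<close>, \<open>adj_cinner\<close>).
\<close>

section \<open>Complex inner products\<close>

lemma cinner_add_right: "cinner x (y + z) = cinner x y + cinner x z"
  for x :: "'a :: complex_inner"
  by (metis cinner_add_left cinner_commute complex_cnj_add)

lemma cinner_scaleC_right: "cinner x (c *\<^sub>C y) = cnj c * cinner x y"
  for x :: "'a :: complex_inner"
  by (metis cinner_scaleC_left cinner_commute complex_cnj_mult)

lemma cinner_diff_left: "cinner (x - y) z = cinner x z - cinner y z"
  for x :: "'a :: complex_inner"
  by (metis add_diff_cancel_right' cinner_add_left diff_add_cancel)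

lemma cinner_diff_right: "cinner x (y - z) = cinner x y - cinner x z"
  for x :: "'a :: complex_inner"
  by (metis add_diff_cancel_right' cinner_add_right diff_add_cancel)

lemma scaleC_diff_right: "c *\<^sub>C (x - y) = c *\<^sub>C x - c *\<^sub>C y"
  for x :: "'a :: complex_inner"
  by (metis add_diff_cancel_right' scaleC_add_right diff_add_cancel)

lemma Im_cinner: "Im (cinner x y) = - inner (\<i> *\<^sub>C x) y"
  for x :: "'a :: complex_inner"
  by (simp flip: Re_cinner add: cinner_scaleC_left)

lemma cinner_eqI:
  fixes x :: "'a :: complex_inner"
  assumes "inner x y = inner x' y'" and "inner (\<i> *\<^sub>C x) y = inner (\<i> *\<^sub>C x') y'"
  shows "cinner x y = cinner x' y'"
  using assms by (simp add: complex_eq_iff Re_cinner Im_cinner)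

lemma cinner_ext: "(\<And>z. cinner z x = cinner z y) \<Longrightarrow> x = y"
  for x :: "'a :: complex_inner"
  by (metis Re_cinner inner_eq_zero_iff inner_diff_right right_minus_eq)

section \<open>The Riesz representation theorem and adjoints\<close>

text \<open>A minimizer of \<open>g x = \<parallel>x\<parallel>\<^sup>2 - 2 f x\<close> represents \<open>f\<close>, because the first variation of \<open>g\<close>
  vanishes there.  A minimizing sequence converges, since the parallelogram law reads
  \<open>\<parallel>x - y\<parallel>\<^sup>2 = 2 g x + 2 g y - 4 g ((x + y) / 2)\<close>.\<close>

lemma riesz_representation:
  fixes f :: "'a :: {real_inner, complete_space} \<Rightarrow> real"
  assumes f: "bounded_linear f"
  obtains z where "\<And>x. f x = inner x z"
proof -
  interpret f: bounded_linear f by fact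
  define g where "g x = (norm x)\<^sup>2 - 2 * f x" for x
  define m where "m = Inf (range g)"
  obtain K where K: "\<And>x. norm (f x) \<le> norm x * K" using f.bounded by blast
  have below: "- K\<^sup>2 \<le> g x" for x
  proof -
    have "f x \<le> norm x * K" using K[of x] by simp
    moreover have "0 \<le> (norm x - K)\<^sup>2" by simp
    ultimately show ?thesis by (simp add: g_def power2_diff)
  qed
  have bdd: "bdd_below (range g)" using below by (intro bdd_belowI) auto
  have m: "m \<le> g x" for x unfolding m_def using bdd by (simp add: cInf_lower)
  have "\<exists>x. g x < m + inverse (real (Suc n))" for n
  proof -
    have "Inf (range g) < m + inverse (real (Suc n))" by (simp add: m_def)
    then show ?thesis by (simp add: cInf_less_iff[OF _ bdd])
  qed
  then obtain X where X: "\<And>n. g (X n) < m + inverse (real (Suc n))" by metis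
  have para: "(norm (x - y))\<^sup>2 \<le> 2 * (g x - m) + 2 * (g y - m)" for x y
  proof -
    have "(norm (x - y))\<^sup>2 = 2 * g x + 2 * g y - 4 * g ((1/2) *\<^sub>R (x + y))"
      by (simp add: g_def f.scaleR f.add power2_norm_eq_inner inner_add inner_diff
          inner_commute algebra_simps)
    then show ?thesis using m[of "(1/2) *\<^sub>R (x + y)"] by simp
  qed
  have "Cauchy X"
  proof (rule CauchyI)
    fix e :: real assume "0 < e"
    then obtain N where N: "inverse (real (Suc N)) < e\<^sup>2 / 4"
      using reals_Archimedean[of "e\<^sup>2 / 4"] by auto
    have "norm (X k - X n) < e" if "N \<le> k" "N \<le> n" for k n
    proof -
      have "inverse (real (Suc k)) \<le> inverse (real (Suc N))"
        "inverse (real (Suc n)) \<le> inverse (real (Suc N))"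
        using that by (auto intro!: le_imp_inverse_le)
      then have "(norm (X k - X n))\<^sup>2 < e\<^sup>2"
        using para[of "X k" "X n"] X[of k] X[of n] N by argo
      then show ?thesis using \<open>0 < e\<close> by (simp add: power2_less_imp_less)
    qed
    then show "\<exists>M. \<forall>k\<ge>M. \<forall>n\<ge>M. norm (X k - X n) < e" by blast
  qed
  then obtain z where z: "X \<longlonglongrightarrow> z" using Cauchy_convergent convergent_def by blast
  have "(\<lambda>n. g (X n)) \<longlonglongrightarrow> g z"
    unfolding g_def by (intro tendsto_intros f.tendsto z)
  moreover have "(\<lambda>n. m + inverse (real (Suc n))) \<longlonglongrightarrow> m + 0"
    by (intro tendsto_intros LIMSEQ_inverse_real_of_nat)
  ultimately have "g z \<le> m + 0"
    by (rule LIMSEQ_le) (use X in \<open>auto intro: less_imp_le\<close>)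
  then have min: "g z \<le> g x" for x using m[of x] by simp
  have "f h = inner h z" for h
  proof (rule ccontr)
    assume ne: "f h \<noteq> inner h z"
    define d where "d = f h - inner h z"
    define c where "c = (norm h)\<^sup>2 + 1"
    have "c > 0" by (simp add: c_def add_nonneg_pos)
    have "d \<noteq> 0" using ne by (simp add: d_def)
    have fh: "f h = d + inner h z" by (simp add: d_def)
    \<comment> \<open>Moving by \<open>t h\<close> changes \<open>g\<close> by \<open>t\<^sup>2 \<parallel>h\<parallel>\<^sup>2 - 2 t d\<close>, which is negative at \<open>t = d / c\<close>.\<close>
    have "g (z + (d / c) *\<^sub>R h) - g z = (d / c)\<^sup>2 * (norm h)\<^sup>2 - 2 * (d / c) * d"
      unfolding g_def power2_norm_eq_inner
      by (simp add: f.add f.scaleR fh inner_add inner_commute power2_eq_square algebra_simps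
          add_divide_distrib)
    also have "\<dots> \<le> (d / c)\<^sup>2 * c - 2 * (d / c) * d"
      by (intro diff_right_mono mult_left_mono) (simp_all add: c_def)
    also have "\<dots> = - (d\<^sup>2 / c)" using \<open>c > 0\<close> by (simp add: power2_eq_square field_simps)
    also have "\<dots> < 0" using \<open>c > 0\<close> \<open>d \<noteq> 0\<close> by simp
    finally show False using min[of "z + (d / c) *\<^sub>R h"] by simp
  qed
  then show thesis using that by blast
qed

lemma bounded_opsD: "T \<in> bounded_ops \<Longrightarrow> blinfun_apply T (c *\<^sub>C x) = c *\<^sub>C blinfun_apply T x"
  by (simp add: bounded_ops_def)

lemma bounded_ops_diff: "S \<in> bounded_ops \<Longrightarrow> T \<in> bounded_ops \<Longrightarrow> S - T \<in> bounded_ops"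
  by (simp add: bounded_ops_def blinfun.diff_left scaleC_diff_right)

text \<open>For complex-linear \<open>T\<close>, the adjoint with respect to the real inner product is also the
  adjoint with respect to the complex one.\<close>

lemma adjoint_exists:
  fixes T :: "'a :: chilbert_space \<Rightarrow>\<^sub>L 'a"
  assumes T: "T \<in> bounded_ops"
  shows "\<exists>S\<in>bounded_ops. \<forall>x y. cinner (T x) y = cinner x (S y)"
proof -
  have "\<exists>z. \<forall>x. inner (T x) y = inner x z" for y
  proof -
    have "bounded_linear (\<lambda>x. inner (T x) y)"
      by (intro bounded_linear_intros)
    then show ?thesis by (rule riesz_representation) blast
  qed
  then obtain s where s: "\<And>x y. inner (T x) y = inner x (s y)" by metis
  have cs: "cinner (T x) y = cinner x (s y)" for x y
    by (rule cinner_eqI) (simp_all add: s flip: bounded_opsD[OF T])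
  have add: "s (x + y) = s x + s y" for x y
    by (rule cinner_ext) (simp add: cinner_add_right flip: cs)
  have scale: "s (c *\<^sub>C x) = c *\<^sub>C s x" for c x
    by (rule cinner_ext) (simp add: cinner_scaleC_right flip: cs)
  have "norm (s y) \<le> norm y * norm T" for y
  proof -
    have "(norm (s y))\<^sup>2 = inner (T (s y)) y" by (simp add: s power2_norm_eq_inner)
    also have "\<dots> \<le> norm (T (s y)) * norm y" by (rule norm_cauchy_schwarz)
    also have "\<dots> \<le> norm T * norm (s y) * norm y" by (simp add: mult_right_mono norm_blinfun)
    finally have "norm (s y) * norm (s y) \<le> norm (s y) * (norm y * norm T)"
      by (simp add: power2_eq_square ac_simps)
    then show ?thesis by (cases "s y = 0") simp_all
  qed
  then have bl: "bounded_linear s"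
    using add scale by (intro bounded_linear_intro) (auto simp flip: scaleC_of_real)
  show ?thesis
  proof (intro bexI allI)
    show "Blinfun s \<in> bounded_ops"
      by (simp add: bounded_ops_def bounded_linear_Blinfun_apply[OF bl] scale)
    show "cinner (T x) y = cinner x (Blinfun s y)" for x y
      by (simp add: bounded_linear_Blinfun_apply[OF bl] cs)
  qed
qed

lemma adj_cinner:
  fixes T :: "'a :: chilbert_space \<Rightarrow>\<^sub>L 'a"
  assumes T: "T \<in> bounded_ops"
  shows "cinner (T x) y = cinner x (adj T y)"
proof -
  have "\<exists>!S. S \<in> bounded_ops \<and> (\<forall>x y. cinner (T x) y = cinner x (S y))"
  proof (rule ex_ex1I)
    show "\<exists>S. S \<in> bounded_ops \<and> (\<forall>x y. cinner (T x) y = cinner x (S y))"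
      using adjoint_exists[OF T] by blast
    fix S S' :: "'a \<Rightarrow>\<^sub>L 'a"
    assume "S \<in> bounded_ops \<and> (\<forall>x y. cinner (T x) y = cinner x (S y))"
      and "S' \<in> bounded_ops \<and> (\<forall>x y. cinner (T x) y = cinner x (S' y))"
    then have "cinner x (S y) = cinner x (S' y)" for x y by metis
    then have "S y = S' y" for y by (rule cinner_ext)
    then show "S = S'" by (rule blinfun_eqI)
  qed
  from theI'[OF this] show ?thesis unfolding adj_def by blast
qed

section \<open>Positive operators\<close>

lemma pos_ops_bounded: "W \<in> pos_ops \<Longrightarrow> W \<in> bounded_ops"
  by (simp add: pos_ops_def)

lemma pos_ops_inner_nonneg: "W \<in> pos_ops \<Longrightarrow> 0 \<le> inner (blinfun_apply W x) x"
  by (simp add: pos_ops_def complex_nonneg_Reals_iff flip: Re_cinner)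

text \<open>Polarization: the form is real on the diagonal, in particular at \<open>x + y\<close> and
  \<open>x + \<i> y\<close>.\<close>

lemma pos_ops_hermitian:
  assumes "W \<in> pos_ops"
  shows "cinner (blinfun_apply W x) y = cinner x (blinfun_apply W y)"
proof -
  have real: "Im (cinner (blinfun_apply W z) z) = 0" for z
    using assms by (simp add: pos_ops_def complex_nonneg_Reals_iff)
  note expand = blinfun.add_right bounded_opsD[OF pos_ops_bounded[OF assms]]
    cinner_add_left cinner_add_right cinner_scaleC_left cinner_scaleC_right
  have "Im (cinner (blinfun_apply W x) y) + Im (cinner (blinfun_apply W y) x) = 0"
    using real[of "x + y"] real[of x] real[of y] by (simp add: expand)
  moreover have "Re (cinner (blinfun_apply W y) x) = Re (cinner (blinfun_apply W x) y)"
    using real[of "x + \<i> *\<^sub>C y"] real[of x] real[of y] by (simp add: expand)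
  ultimately have "cinner (blinfun_apply W x) y = cnj (cinner (blinfun_apply W y) x)"
    by (simp add: complex_eq_iff)
  then show ?thesis by (simp flip: cinner_commute)
qed

lemma pos_opsI:
  assumes "W \<in> bounded_ops"
    and herm: "\<And>x. cinner (blinfun_apply W x) x = cinner x (blinfun_apply W x)"
    and "\<And>x. 0 \<le> inner (blinfun_apply W x) x"
  shows "W \<in> pos_ops"
proof -
  have "Im (cinner (blinfun_apply W x) x) = 0" for x
    using herm[of x] cinner_commute[of x "blinfun_apply W x"] by (simp add: complex_eq_iff)
  then show ?thesis using assms
    by (simp add: pos_ops_def complex_nonneg_Reals_iff Re_cinner)
qed

text \<open>A form of the Cauchy--Schwarz inequality for the semi-inner product \<open>\<langle>W \<cdot>, \<cdot>\<rangle>\<close>: evaluate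
  the nonnegative form at \<open>z - W z / \<parallel>W\<parallel>\<close>.\<close>

lemma pos_ops_norm_le:
  fixes W :: "'a :: complex_inner \<Rightarrow>\<^sub>L 'a"
  assumes W: "W \<in> pos_ops"
  shows "(norm (W z))\<^sup>2 \<le> norm W * inner (W z) z"
proof (cases "W = 0")
  case False
  define k where "k = norm W"
  define t where "t = inverse k"
  have "k > 0" using False by (simp add: k_def)
  have sym: "inner (W (W z)) z = inner (W z) (W z)"
    using pos_ops_hermitian[OF W, of "W z" z] by (metis Re_cinner)
  have "0 \<le> inner (W (z - t *\<^sub>R W z)) (z - t *\<^sub>R W z)"
    by (rule pos_ops_inner_nonneg[OF W])
  also have "\<dots> = inner (W z) z - 2 * t * (norm (W z))\<^sup>2 + t\<^sup>2 * inner (W (W z)) (W z)"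
    unfolding power2_norm_eq_inner
    by (simp add: blinfun.diff_right blinfun.scaleR_right inner_diff sym algebra_simps
        power2_eq_square)
  also have "inner (W (W z)) (W z) \<le> k * (norm (W z))\<^sup>2"
  proof -
    have "inner (W (W z)) (W z) \<le> norm (W (W z)) * norm (W z)" by (rule norm_cauchy_schwarz)
    also have "\<dots> \<le> k * norm (W z) * norm (W z)"
      by (simp add: k_def mult_right_mono norm_blinfun)
    finally show ?thesis by (simp add: power2_eq_square ac_simps)
  qed
  finally have "0 \<le> inner (W z) z - 2 * t * (norm (W z))\<^sup>2 + t\<^sup>2 * (k * (norm (W z))\<^sup>2)"
    by (simp add: mult_left_mono)
  also have "\<dots> = inner (W z) z - (norm (W z))\<^sup>2 / k"
    using \<open>k > 0\<close> by (simp add: t_def power2_eq_square field_simps)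
  finally show ?thesis using \<open>k > 0\<close> by (simp add: k_def field_simps)
qed simp

lemma pos_ops_eq_0: "W \<in> pos_ops \<Longrightarrow> inner (blinfun_apply W z) z = 0 \<Longrightarrow> blinfun_apply W z = 0"
  using pos_ops_norm_le[of W z] by simp

lemma op_le_antisym:
  assumes "op_le X Y" and "op_le Y X"
  shows "X = Y"
proof (rule blinfun_eqI)
  fix z
  have "inner ((Y - X) z) z = 0"
    using pos_ops_inner_nonneg[of "Y - X" z] pos_ops_inner_nonneg[of "X - Y" z] assms
    by (simp add: op_le_def blinfun.diff_left inner_diff)
  then have "(Y - X) z = 0" using assms pos_ops_eq_0 op_le_def by blast
  then show "blinfun_apply X z = blinfun_apply Y z" by (simp add: blinfun.diff_left)
qed

lemma shorted_eqI:
  assumes "X \<in> shorted_candidates W S"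
    and "\<And>Y. Y \<in> shorted_candidates W S \<Longrightarrow> op_le Y X"
  shows "shorted W S = X"
  unfolding shorted_def using assms by (intro the_equality) (auto intro: op_le_antisym)

section \<open>Compressions from weighted orthogonal decompositions\<close>

definition csubspace :: "'a :: complex_inner set \<Rightarrow> bool"
  where "csubspace T \<longleftrightarrow>
    T \<noteq> {} \<and> (\<forall>x\<in>T. \<forall>y\<in>T. x + y \<in> T) \<and> (\<forall>c. \<forall>x\<in>T. c *\<^sub>C x \<in> T)"

lemma csubspace_diff:
  assumes "csubspace T" and "x \<in> T" and "y \<in> T"
  shows "x - y \<in> T"
proof -
  have "x + complex_of_real (-1) *\<^sub>C y \<in> T"
    using assms unfolding csubspace_def by blast
  then show ?thesis unfolding scaleC_of_real by simp
qed

lemma csubspace_op_range: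
  assumes "T \<in> bounded_ops"
  shows "csubspace (op_range T)"
proof -
  have "blinfun_apply T x + blinfun_apply T y \<in> op_range T" for x y
    by (metis blinfun.add_right rangeI)
  moreover have "c *\<^sub>C blinfun_apply T x \<in> op_range T" for c x
    by (metis bounded_opsD[OF assms] rangeI)
  ultimately show ?thesis by (auto simp: csubspace_def)
qed

text \<open>The relation \<open>D x e\<close> below says that \<open>e\<close> is a \<open>W\<close>-orthogonal projection of \<open>x\<close> to \<open>T\<close>.  Its
  image under \<open>W\<close> is unique: for two such vectors \<open>e\<close> and \<open>e'\<close>, the difference \<open>d = e - e'\<close> lies in
  \<open>T\<close> and in its \<open>W\<close>-orthogonal complement, so \<open>\<langle>W d, d\<rangle> = 0\<close> and hence \<open>W d = 0\<close>.  As \<open>D\<close> is a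
  linear relation, uniqueness makes \<open>x \<mapsto> W e\<close> linear.\<close>

lemma compression_apply:
  fixes W :: "'a :: complex_inner \<Rightarrow>\<^sub>L 'a"
  assumes W: "W \<in> pos_ops" and T: "csubspace T"
    and dec: "\<And>x. \<exists>e\<in>T. x - e \<in> weighted_ortho_compl W T"
    and e: "e \<in> T" "x - e \<in> weighted_ortho_compl W T"
  shows "compression W T x = W e"
proof -
  define D where "D x e \<longleftrightarrow> e \<in> T \<and> (\<forall>y\<in>T. cinner (W e) y = cinner (W x) y)" for x e
  have D_iff: "D x e \<longleftrightarrow> e \<in> T \<and> x - e \<in> weighted_ortho_compl W T" for x e
    by (auto simp: D_def weighted_ortho_compl_def blinfun.diff_right cinner_diff_left)
  note herm = pos_ops_hermitian[OF W]
  note W_scale = bounded_opsD[OF pos_ops_bounded[OF W]]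
  have D_unique: "W e = W e'" if "D x e" "D x e'" for x e e'
  proof -
    have "e - e' \<in> T" using that T csubspace_diff by (auto simp: D_def)
    then have "cinner (W (e - e')) (e - e') = 0"
      using that by (simp add: D_def blinfun.diff_right cinner_diff_left)
    then have "inner (W (e - e')) (e - e') = 0" by (simp flip: Re_cinner)
    then have "W (e - e') = 0" using pos_ops_eq_0 W by blast
    then show ?thesis by (simp add: blinfun.diff_right)
  qed
  obtain E where E: "\<And>x. D x (E x)" using dec D_iff by metis
  have ET: "E x \<in> T" and EW: "y \<in> T \<Longrightarrow> cinner (W (E x)) y = cinner (W x) y" for x y
    using E by (auto simp: D_def)
  define n where "n x = W (E x)" for x

  \<comment> \<open>Both sides equal \<open>\<langle>W (E x), E y\<rangle>\<close>.\<close>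
  have n_herm: "cinner (n x) y = cinner x (n y)" for x y
  proof -
    have "cinner (n x) y = cinner (E x) (W y)" by (simp add: n_def herm)
    also have "\<dots> = cnj (cinner (W y) (E x))" by (rule cinner_commute)
    also have "\<dots> = cnj (cinner (W (E y)) (E x))" by (simp add: EW ET)
    also have "\<dots> = cinner (E x) (W (E y))" by (rule cinner_commute[symmetric])
    also have "\<dots> = cinner (W (E x)) (E y)" by (simp add: herm)
    also have "\<dots> = cinner (W x) (E y)" by (simp add: EW ET)
    also have "\<dots> = cinner x (n y)" by (simp add: n_def herm)
    finally show ?thesis .
  qed
  have n_diag: "inner (n x) x = inner (W (E x)) (E x)" for x
    by (metis n_def n_herm Re_cinner EW ET herm)
  have residual: "inner (W (x - E x)) (x - E x) = inner (W x) x - inner (n x) x" for x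
  proof -
    have "inner (W x) (E x) = inner (n x) x" by (metis n_diag Re_cinner EW ET)
    then show ?thesis
      by (simp add: blinfun.diff_right inner_diff n_diag) (simp add: n_def flip: n_diag)
  qed

  have add: "n (x + y) = n x + n y" for x y
  proof -
    have "D (x + y) (E x + E y)"
      using ET T by (simp add: D_def EW blinfun.add_right cinner_add_left csubspace_def)
    from D_unique[OF E this] show ?thesis by (simp add: n_def blinfun.add_right)
  qed
  have scale: "n (c *\<^sub>C x) = c *\<^sub>C n x" for c x
  proof -
    have "D (c *\<^sub>C x) (c *\<^sub>C E x)"
      using ET T by (simp add: D_def EW W_scale cinner_scaleC_left csubspace_def)
    from D_unique[OF E this] show ?thesis by (simp add: n_def W_scale)
  qed
  have bound: "norm (n x) \<le> norm x * norm W" for x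
  proof -
    have "(norm (n x))\<^sup>2 \<le> norm W * inner (n x) x"
      using pos_ops_norm_le[OF W, of "E x"] by (simp add: n_diag) (simp add: n_def)
    also have "\<dots> \<le> norm W * inner (W x) x"
      using pos_ops_inner_nonneg[OF W, of "x - E x"] by (simp add: residual mult_left_mono)
    also have "\<dots> \<le> norm W * ((norm W * norm x) * norm x)"
      by (intro mult_left_mono order_trans[OF norm_cauchy_schwarz] mult_right_mono norm_blinfun)
        simp_all
    also have "\<dots> = (norm x * norm W)\<^sup>2" by (simp add: power2_eq_square ac_simps)
    finally show ?thesis by (rule power2_le_imp_le) simp
  qed
  have bl: "bounded_linear n"
    using add scale bound by (intro bounded_linear_intro) (auto simp flip: scaleC_of_real)
  define N where "N = Blinfun n"
  have N: "blinfun_apply N = n" by (simp add: N_def bounded_linear_Blinfun_apply[OF bl])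
  have N_ops: "N \<in> bounded_ops" by (simp add: bounded_ops_def N scale)

  have "shorted W T = W - N"
  proof (rule shorted_eqI)
    have "W - N \<in> pos_ops"
    proof (rule pos_opsI)
      show "W - N \<in> bounded_ops" by (simp add: bounded_ops_diff N_ops pos_ops_bounded W)
      show "cinner ((W - N) x) x = cinner x ((W - N) x)" for x
        by (simp add: blinfun.diff_left cinner_diff_left cinner_diff_right N herm n_herm)
      show "0 \<le> inner ((W - N) x) x" for x
        using pos_ops_inner_nonneg[OF W, of "x - E x"] unfolding residual
        by (simp add: blinfun.diff_left inner_diff N)
    qed
    moreover have "N \<in> pos_ops"
      by (rule pos_opsI) (simp_all add: N_ops N n_herm n_diag pos_ops_inner_nonneg W)
    moreover have "op_range (W - N) \<subseteq> ortho_compl T"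
      by (auto simp: ortho_compl_def blinfun.diff_left cinner_diff_left N n_def EW)
    ultimately show "W - N \<in> shorted_candidates W T"
      by (simp add: shorted_candidates_def op_le_def pos_ops_bounded)
  next
    fix Y assume Y: "Y \<in> shorted_candidates W T"
    then have Yp: "Y \<in> pos_ops" and WY: "W - Y \<in> pos_ops"
      and YT: "op_range Y \<subseteq> ortho_compl T"
      by (auto simp: shorted_candidates_def op_le_def)
    have "W - N - Y \<in> pos_ops"
    proof (rule pos_opsI)
      show "W - N - Y \<in> bounded_ops"
        by (simp add: bounded_ops_diff N_ops pos_ops_bounded W Yp)
      show "cinner ((W - N - Y) x) x = cinner x ((W - N - Y) x)" for x
        by (simp add: blinfun.diff_left cinner_diff_left cinner_diff_right N herm n_herm
            pos_ops_hermitian[OF Yp])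
      show "0 \<le> inner ((W - N - Y) x) x" for x
      proof -
        have "cinner (Y z) (E x) = 0" for z using YT ET by (auto simp: ortho_compl_def)
        then have right: "inner (Y z) (E x) = 0" for z by (simp flip: Re_cinner)
        have left: "inner (Y (E x)) x = 0"
          using right[of x] pos_ops_hermitian[OF Yp, of "E x" x]
          by (metis Re_cinner inner_commute)
        have "inner (Y x) x = inner (Y (x - E x)) (x - E x)"
          by (simp add: blinfun.diff_right inner_diff left right)
        moreover have "0 \<le> inner ((W - Y) (x - E x)) (x - E x)"
          by (rule pos_ops_inner_nonneg[OF WY])
        ultimately show ?thesis using residual[of x]
          by (simp only: blinfun.diff_left inner_diff_left N)
      qed
    qed
    then show "op_le Y (W - N)" by (simp add: op_le_def)
  qed
  then have "compression W T x = n x" by (simp add: compression_def flip: N)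
  also have "\<dots> = W e" using D_unique[OF E] e by (simp add: n_def D_iff)
  finally show ?thesis .
qed

text \<open>The identity \<open>W Q = Q\<^sup>* W\<close> gives \<open>\<langle>W (x - Q x), Q z\<rangle> = \<langle>W Q (x - Q x), z\<rangle>\<close>, and
  \<open>Q (x - Q x) = 0\<close>.\<close>

lemma compatible_decomposition:
  fixes W :: "'a :: chilbert_space \<Rightarrow>\<^sub>L 'a"
  assumes "compatible W S"
  shows "\<exists>e\<in>S. x - e \<in> weighted_ortho_compl W S"
proof -
  obtain Q where Q: "Q \<in> bounded_ops" "Q o\<^sub>L Q = Q" "op_range Q = S" "W o\<^sub>L Q = adj Q o\<^sub>L W"
    using assms by (auto simp: compatible_def)
  have QQ: "Q (Q z) = Q z" for z using Q(2) by (metis blinfun_apply_blinfun_compose)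
  have WQ: "adj Q (W z) = W (Q z)" for z using Q(4) by (metis blinfun_apply_blinfun_compose)
  have "cinner (W (x - Q x)) (Q z) = 0" for z
  proof -
    have "cinner (W (x - Q x)) (Q z) = cnj (cinner (Q z) (W (x - Q x)))" by (rule cinner_commute)
    also have "\<dots> = cnj (cinner z (W (Q (x - Q x))))" by (simp add: adj_cinner[OF Q(1)] WQ)
    also have "Q (x - Q x) = 0" by (simp add: blinfun.diff_right QQ)
    also have "cnj (cinner z (W 0)) = 0"
      using cinner_diff_right[of z 0 0] by simp
    finally show ?thesis .
  qed
  then have "x - Q x \<in> weighted_ortho_compl W S"
    by (auto simp: weighted_ortho_compl_def simp flip: Q(3))
  moreover have "Q x \<in> S" using Q(3) by blast
  ultimately show ?thesis by blast
qed

lemma weighted_ortho_compl_add: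
  "x \<in> weighted_ortho_compl W S \<Longrightarrow> y \<in> weighted_ortho_compl W S
    \<Longrightarrow> x + y \<in> weighted_ortho_compl W S"
  by (simp add: weighted_ortho_compl_def blinfun.add_right cinner_add_left)

lemma weighted_ortho_compl_sym:
  assumes W: "W \<in> pos_ops" and ST: "S \<subseteq> weighted_ortho_compl W T"
  shows "T \<subseteq> weighted_ortho_compl W S"
proof -
  have "cinner (blinfun_apply W t) s = 0" if "t \<in> T" "s \<in> S" for s t
  proof -
    have "cinner (blinfun_apply W t) s = cinner t (blinfun_apply W s)"
      by (rule pos_ops_hermitian[OF W])
    also have "\<dots> = cnj (cinner (blinfun_apply W s) t)" by (rule cinner_commute)
    also have "cinner (blinfun_apply W s) t = 0"
      using that ST unfolding weighted_ortho_compl_def by blast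
    finally show ?thesis by simp
  qed
  then show ?thesis by (auto simp: weighted_ortho_compl_def)
qed

text \<open>If \<open>x - (t + u)\<close> is \<open>W\<close>-orthogonal to \<open>S\<close>, then \<open>x - t = (x - (t + u)) + u\<close> is a sum of
  two vectors that are \<open>W\<close>-orthogonal to \<open>T\<close>, so \<open>t\<close> computes the compression to \<open>T\<close>, and
  likewise \<open>u\<close> the compression to \<open>U\<close>.\<close>

lemma compression_add:
  fixes W :: "'a :: complex_inner \<Rightarrow>\<^sub>L 'a"
  assumes W: "W \<in> pos_ops" and sub: "csubspace S" "csubspace T" "csubspace U"
    and S: "S = T + U" and orth: "U \<subseteq> weighted_ortho_compl W T"
    and dec: "\<And>x. \<exists>e\<in>S. x - e \<in> weighted_ortho_compl W S"
  shows "compression W S = compression W T + compression W U"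
proof -
  have zero: "0 \<in> V" if "csubspace V" for V :: "'a set"
    using that csubspace_diff[OF that] unfolding csubspace_def by (metis diff_self ex_in_conv)
  have "T \<subseteq> S" "U \<subseteq> S"
    using set_zero_plus2[OF zero[OF sub(3)], of T] set_zero_plus2[OF zero[OF sub(2)], of U]
    by (simp_all add: S add.commute)
  then have anti: "x \<in> weighted_ortho_compl W T \<and> x \<in> weighted_ortho_compl W U"
    if "x \<in> weighted_ortho_compl W S" for x
    using that by (auto simp: weighted_ortho_compl_def)
  have split: "\<exists>t\<in>T. \<exists>u\<in>U. x - (t + u) \<in> weighted_ortho_compl W S
      \<and> x - t \<in> weighted_ortho_compl W T \<and> x - u \<in> weighted_ortho_compl W U" for x
  proof -
    obtain e where e: "e \<in> S" "x - e \<in> weighted_ortho_compl W S" using dec by blast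
    then obtain t u where tu: "t \<in> T" "u \<in> U" "e = t + u"
      unfolding S by (elim set_plus_elim)
    have "(x - e) + u \<in> weighted_ortho_compl W T" "(x - e) + t \<in> weighted_ortho_compl W U"
      using anti[OF e(2)] orth weighted_ortho_compl_sym[OF W orth] tu(1,2)
      by (blast intro: weighted_ortho_compl_add)+
    moreover have "(x - e) + u = x - t" "(x - e) + t = x - u" using tu(3) by simp_all
    ultimately show ?thesis using e(2) tu by auto
  qed
  show ?thesis
  proof (rule blinfun_eqI)
    fix x
    obtain t u where tu: "t \<in> T" "u \<in> U" "x - (t + u) \<in> weighted_ortho_compl W S"
        "x - t \<in> weighted_ortho_compl W T" "x - u \<in> weighted_ortho_compl W U"
      using split by blast
    have "t + u \<in> S" using tu(1,2) S by blast
    then have "compression W S x = W (t + u)"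
      using compression_apply[OF W sub(1) dec _ tu(3)] by blast
    moreover have "compression W T x = W t"
      using compression_apply[OF W sub(2) _ tu(1,4)] split by blast
    moreover have "compression W U x = W u"
      using compression_apply[OF W sub(3) _ tu(2,5)] split by blast
    ultimately show "compression W S x = (compression W T + compression W U) x"
      by (simp add: blinfun.add_left blinfun.add_right)
  qed
qed

section \<open>Additivity of the compression along the left weighted star order\<close>

theorem corollary5p7:
  fixes A B W :: "'a :: chilbert_space \<Rightarrow>\<^sub>L 'a"
  assumes "separable_space (euclidean :: 'a topology)"
    and "A \<in> bounded_ops" and "B \<in> bounded_ops"
    and "closed (op_range (A + B))"
    and "W \<in> pos_ops"
    and "compatible W (op_range (A + B))"
    and "left_weighted_star_le W A (A + B)"
  shows "compression W (op_range (A + B)) = compression W (op_range A) + compression W (op_range B)"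
proof (rule compression_add)
  show "W \<in> pos_ops" by fact
  have "A + B \<in> bounded_ops"
    using assms(2,3) by (simp add: bounded_ops_def blinfun.add_left scaleC_add_right)
  then show "csubspace (op_range (A + B))" by (rule csubspace_op_range)
  show "csubspace (op_range A)" "csubspace (op_range B)"
    using assms(2,3) by (simp_all add: csubspace_op_range)
  show "op_range (A + B) = op_range A + op_range B"
      "op_range B \<subseteq> weighted_ortho_compl W (op_range A)"
    using assms(7) by (simp_all add: left_weighted_star_le_def left_minus_le_def is_direct_sum_def)
  show "\<exists>e\<in>op_range (A + B). x - e \<in> weighted_ortho_compl W (op_range (A + B))" for x
    using assms(6) by (rule compatible_decomposition)
qed

end
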